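(* Let $0<k_F<\pi$ and let $\lambda\in\mathbb{C}$ with $\lambda\neq\pm1$. Set $$r(\lambda)=\frac{\lambda-1}{\lambda+1},\qquad \beta(\lambda)=\frac{1}{2\pi i}\log r(\lambda),$$ and let $D(z;\lambda)$, for $|z|<1$, be the Szegő function $$D(z;\lambda)=\exp\left\{\frac{1}{4\pi}\int_{-\pi}^{\pi}\frac{e^{i\theta}+z}{e^{i\theta}-z}\,\ln f(e^{i\theta};\lambda)\,d\theta\right\}$$ of the step symbol $f(e^{i\theta};\lambda)=\lambda-1$ for $|\theta|<k_F$ and $f(e^{i\theta};\lambda)=\lambda+1$ for $k_F<|\theta|\le\pi$. Then for all $|z|<1$, $$D(z;\lambda)=(\lambda+1)^{1/2}\,r(\lambda)^{k_F/(2\pi)}\left(\frac{1-ze^{-ik_F}}{1-ze^{ik_F}}\right)^{\beta(\lambda)}.$$ Moreover, the nontangential limit $$D_{\mathrm{reg}}(e^{ik_F};\lambda):=\lim_{\substack{z\to e^{ik_F}\\ |z|<1}}D(z;\lambda)\,(1-ze^{-ik_F})^{-\beta(\lambda)}$$ exists and equals $$D_{\mathrm{reg}}(e^{ik_F};\lambda)=(\lambda+1)^{1/2}\,e^{i\pi\beta(\lambda)/2}\,(2\sin k_F)^{-\beta(\lambda)};$$ equivalently, $$D_{\mathrm{reg}}(e^{ik_F};\lambda)=\exp\left\{\frac12\log(\lambda+1)+\frac14\log\left(\frac{\lambda-1}{\lambda+1}\right)-\frac{1}{2\pi i}\log\left(\frac{\lambda-1}{\lambda+1}\right)\log(2\sin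 k_F)\right\}.$$
   Context: All logarithms and complex powers are principal: $\log w=\ln|w|+i\arg w$ with $\arg w\in(-\pi,\pi]$, and $w^{a}=e^{a\log w}$ for $w\ne0$. The logarithm of the symbol is $\ln f(e^{i\theta};\lambda)=\log(\lambda+1)+\log r(\lambda)\,\chi_{(-k_F,k_F)}(\theta)$, where $\chi_{(-k_F,k_F)}$ is the indicator function of the interval $(-k_F,k_F)\subset[-\pi,\pi]$. A nontangential limit at $e^{ik_F}$ is a limit taken with $z$ approaching $e^{ik_F}$ inside a cone (Stolz angle) with vertex $e^{ik_F}$ contained in the open unit disc. *)

theory Defs
  imports "HOL-Analysis.Analysis"
begin

(* Ln and powr on complex are the principal branches: Im (Ln w) lies in (-pi, pi] for w \<noteq> 0. *)

definition step_symbol :: "real \<Rightarrow> complex \<Rightarrow> real \<Rightarrow> complex" where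
  "step_symbol k lam \<theta> = (if \<bar>\<theta>\<bar> < k then lam - 1 else lam + 1)"

definition rr :: "complex \<Rightarrow> complex" where
  "rr lam = (lam - 1) / (lam + 1)"

definition beta :: "complex \<Rightarrow> complex" where
  "beta lam = 1 / (2 * of_real pi * \<i>) * Ln (rr lam)"

(* The logarithm of the symbol on (-k, k) is Ln (lam + 1) + Ln (rr lam), which may differ from
   Ln (lam - 1) by a multiple of 2 * pi * i. *)
definition ln_step_symbol :: "real \<Rightarrow> complex \<Rightarrow> real \<Rightarrow> complex" where
  "ln_step_symbol k lam \<theta> = Ln (lam + 1) + Ln (rr lam) * indicator {-k<..<k} \<theta>"

lemma exp_ln_step_symbol:
  assumes "lam \<noteq> 1" "lam \<noteq> -1"
  shows "exp (ln_step_symbol k lam \<theta>) = step_symbol k lam \<theta>"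
proof -
  have "lam + 1 \<noteq> 0" "lam - 1 \<noteq> 0"
    using assms by (auto simp: add_eq_0_iff2)
  then show ?thesis
    by (auto simp: ln_step_symbol_def step_symbol_def rr_def exp_add indicator_def abs_less_iff)
qed

(* Szego function of the symbol whose logarithm is g *)
definition szego_function :: "(real \<Rightarrow> complex) \<Rightarrow> complex \<Rightarrow> complex" where
  "szego_function g z =
     exp (1 / (4 * of_real pi) *
       integral {-pi..pi} (\<lambda>\<theta>. (cis \<theta> + z) / (cis \<theta> - z) * g \<theta>))"

definition D :: "real \<Rightarrow> complex \<Rightarrow> complex \<Rightarrow> complex" where
  "D k lam z = szego_function (ln_step_symbol k lam) z"

(* A truncated open cone with vertex p, contained in the open unit disc. It meets every
   neighbourhood of p; for norm p = 1 the inclusion forces it to stay away from the tangent. *)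
definition stolz_angle :: "complex \<Rightarrow> complex set \<Rightarrow> bool" where
  "stolz_angle p S \<longleftrightarrow>
     (\<exists>\<phi> \<alpha> \<delta>. 0 < \<alpha> \<and> 0 < \<delta> \<and>
        S = {p + rcis s t | s t. 0 < s \<and> s < \<delta> \<and> \<bar>t - \<phi>\<bar> < \<alpha>} \<and> S \<subseteq> ball 0 1)"

definition has_nontangential_limit :: "(complex \<Rightarrow> complex) \<Rightarrow> complex \<Rightarrow> complex \<Rightarrow> bool" where
  "has_nontangential_limit F p L \<longleftrightarrow> (\<forall>S. stolz_angle p S \<longrightarrow> (F \<longlongrightarrow> L) (at p within S))"

definition nontangential_Lim :: "(complex \<Rightarrow> complex) \<Rightarrow> complex \<Rightarrow> complex" where
  "nontangential_Lim F p = (THE L. has_nontangential_limit F p L)"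

definition D_reg_fun :: "real \<Rightarrow> complex \<Rightarrow> complex \<Rightarrow> complex" where
  "D_reg_fun k lam z = D k lam z * (1 - z * cis (-k)) powr (- beta lam)"

definition D_reg :: "real \<Rightarrow> complex \<Rightarrow> complex" where
  "D_reg k lam = nontangential_Lim (D_reg_fun k lam) (cis k)"

lemma ex_stolz_angle:
  assumes "norm p = 1"
  shows "\<exists>S. stolz_angle p S"
proof -
  define S where "S = {p + rcis s t | s t. 0 < s \<and> s < 1 \<and> \<bar>t - (Arg p + pi)\<bar> < pi / 3}"
  have "norm (p + rcis s t) < 1"
    if st: "0 < s" "s < 1" "\<bar>t - (Arg p + pi)\<bar> < pi / 3" for s t
  proof -
    define u where "u = t - (Arg p + pi)"
    have p: "p = cis (Arg p)"
      using assms by (metis rcis_cmod_Arg rcis_def mult_1 of_real_1)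
    have "cos (pi / 3) < cos \<bar>u\<bar>"
      using st by (intro cos_monotone_0_pi) (auto simp: u_def)
    then have c: "1 / 2 < cos u"
      by (simp add: cos_60)
    have "t = Arg p + u + pi"
      by (simp add: u_def)
    then have "rcis s t = p * (- rcis s u)"
      by (subst p) (simp add: rcis_def complex_eq_iff cis.ctr cos_add sin_add algebra_simps)
    then have "norm (p + rcis s t) = norm (1 - rcis s u)"
      using assms by (metis (no_types, opaque_lifting) add_uminus_conv_diff distrib_left mult.right_neutral mult_1
          norm_mult)
    moreover have "(norm (1 - rcis s u))\<^sup>2 = 1 - 2 * s * cos u + ((s * cos u)\<^sup>2 + (s * sin u)\<^sup>2)"
      unfolding cmod_power2 by (simp add: rcis_def power2_eq_square algebra_simps)
    moreover have "(s * cos u)\<^sup>2 + (s * sin u)\<^sup>2 = s\<^sup>2"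
      by (simp add: power_mult_distrib flip: distrib_left)
    moreover have "s * (2 * cos u) > s * s"
      using st c by (intro mult_strict_left_mono) auto
    ultimately have "(norm (p + rcis s t))\<^sup>2 < 1\<^sup>2"
      by (simp add: power2_eq_square)
    then show ?thesis
      by (rule power_less_imp_less_base) simp
  qed
  then have "S \<subseteq> ball 0 1"
    by (auto simp: S_def)
  then have "stolz_angle p S"
    unfolding stolz_angle_def S_def
    by (intro exI[of _ "Arg p + pi"] exI[of _ "pi / 3"] exI[of _ 1]) auto
  then show ?thesis ..
qed

lemma at_within_stolz_angle:
  assumes "stolz_angle p S"
  shows "at p within S \<noteq> bot"
proof -
  from assms obtain \<phi> \<alpha> \<delta> where *: "0 < \<alpha>" "0 < \<delta>"
    "S = {p + rcis s t | s t. 0 < s \<and> s < \<delta> \<and> \<bar>t - \<phi>\<bar> < \<alpha>}"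
    by (auto simp: stolz_angle_def)
  have "\<exists>x\<in>S. x \<noteq> p \<and> dist x p < e" if "e > 0" for e
  proof -
    define s where "s = min e \<delta> / 2"
    have s: "0 < s" "s < e" "s < \<delta>"
      using that * by (auto simp: s_def min_def)
    have "p + rcis s \<phi> \<in> S"
      unfolding *(3) using s * by fastforce
    moreover have "p + rcis s \<phi> \<noteq> p" "dist (p + rcis s \<phi>) p < e"
      using s by (auto simp: dist_norm)
    ultimately show ?thesis by blast
  qed
  then show ?thesis
    by (auto simp: trivial_limit_within islimpt_approachable)
qed

lemma nontangential_Lim_eq:
  assumes "norm p = 1" "has_nontangential_limit F p L"
  shows "nontangential_Lim F p = L"
  unfolding nontangential_Lim_def
proof (rule the_equality)
  fix L' assume "has_nontangential_limit F p L'"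
  moreover obtain S where "stolz_angle p S"
    using ex_stolz_angle assms(1) by blast
  ultimately show "L' = L"
    using assms(2) at_within_stolz_angle tendsto_unique
    unfolding has_nontangential_limit_def by blast
qed (fact assms(2))

end

(* The integrand (e^{i t} + z) / (e^{i t} - z) has the primitive t - 2 i Ln (1 - z e^{-i t}), in
   which the argument of the logarithm stays in the right half-plane for |z| < 1. This gives the
   closed form of D with the logarithm of the quotient split as a difference. Multiplying by
   (1 - z e^{-i k})^{-beta} removes the singular factor at e^{i k}; the remaining factor
   (1 - z e^{i k})^{-beta} is continuous there, because
   1 - e^{2 i k} = 2 sin k e^{i (k - pi/2)} again lies in the right half-plane. *)

theory Submission
  imports Defs
begin

lemma Re_one_minus_mult_cis_pos:
  assumes "norm z < 1"
  shows "0 < Re (1 - z * cis t)"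
proof -
  have "Re (z * cis t) \<le> norm (z * cis t)" by (rule complex_Re_le_cmod)
  with assms show ?thesis by (simp add: norm_mult)
qed

lemma Re_pos_imp_nonzero: "0 < Re x \<Longrightarrow> x \<noteq> 0"
  by auto

lemma has_integral_szego_kernel:
  assumes "norm z < 1" "a \<le> b"
  shows "((\<lambda>t. (cis t + z) / (cis t - z)) has_integral
           (of_real (b - a) - 2 * \<i> * (Ln (1 - z * cis (- b)) - Ln (1 - z * cis (- a))))) {a..b}"
proof -
  \<comment> \<open>The primitive as a holomorphic function of a complex \<open>w\<close>, so that
    complex derivative rules apply; restricting it to the real line gives the vector
    derivative.\<close>
  define F where "F = (\<lambda>w. w - 2 * \<i> * Ln (1 - z * exp (- (\<i> * w))))"
  have F: "F (of_real t) = of_real t - 2 * \<i> * Ln (1 - z * cis (- t))" for t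
    by (simp add: F_def cis_conv_exp)
  have deriv: "((\<lambda>t. F (of_real t)) has_vector_derivative (cis t + z) / (cis t - z)) (at t within {a..b})" for t
  proof -
    define e where "e = exp (- (\<i> * of_real t))"
    have e: "e = cis (- t)" by (simp add: e_def cis_conv_exp)
    have pos: "0 < Re (1 - z * e)"
      unfolding e using assms(1) by (rule Re_one_minus_mult_cis_pos)
    have nonpos: "1 - z * e \<notin> \<real>\<^sub>\<le>\<^sub>0"
      using pos complex_nonpos_Reals_iff by auto
    have ne: "1 - z * e \<noteq> 0" using pos by (rule Re_pos_imp_nonzero)
    have ce: "cis t * e = 1" by (simp add: e cis_mult)
    have "(F has_field_derivative 1 - 2 * \<i> * (z * e * \<i> / (1 - z * e))) (at (of_real t))"
      unfolding F_def using nonpos ne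
      by (auto intro!: derivative_eq_intros simp: e_def field_simps)
    also have "1 - 2 * \<i> * (z * e * \<i> / (1 - z * e)) = (1 + z * e) / (1 - z * e)"
      using ne by (simp add: field_simps)
    \<comment> \<open>Expanding by \<open>cis t\<close>, the inverse of \<open>e\<close>, turns the
      quotient into the kernel.\<close>
    also have "\<dots> = (cis t * (1 + z * e)) / (cis t * (1 - z * e))" by simp
    also have "cis t * (1 + z * e) = cis t + z" using ce by (simp add: algebra_simps)
    also have "cis t * (1 - z * e) = cis t - z" using ce by (simp add: algebra_simps)
    finally show ?thesis by (rule has_vector_derivative_real_field)
  qed
  have "((\<lambda>t. (cis t + z) / (cis t - z)) has_integral F (of_real b) - F (of_real a)) {a..b}"
    using assms(2) deriv by (intro fundamental_theorem_of_calculus)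
  then show ?thesis by (simp add: F algebra_simps)
qed

text \<open>The two logarithms stay apart in the exponent, so that the one singular at
  \<open>cis k\<close> can later cancel term by term.\<close>

lemma D_eq_exp:
  assumes z: "norm z < 1" and k: "0 < k" "k < pi"
  shows "D k lam z = exp (Ln (lam + 1) / 2 + of_real (k / (2 * pi)) * Ln (rr lam)
           + beta lam * (Ln (1 - z * cis (- k)) - Ln (1 - z * cis k)))"
proof -
  let ?K = "\<lambda>t. (cis t + z) / (cis t - z)"
  let ?d = "Ln (1 - z * cis (- k)) - Ln (1 - z * cis k)"
  \<comment> \<open>The endpoints \<open>- pi\<close> and \<open>pi\<close> are the same point of
    the circle, so the logarithms cancel and only the length remains.\<close>
  have full: "(?K has_integral of_real (2 * pi)) {- pi..pi}"
    using has_integral_szego_kernel[OF z, of "- pi" pi] by (simp add: cis_cnj[symmetric])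
  have "(?K has_integral (of_real (2 * k) - 2 * \<i> * ?d)) {- k..k}"
    using has_integral_szego_kernel[OF z, of "- k" k] k by simp
  then have "((\<lambda>t. if t \<in> {- k..k} then ?K t else 0) has_integral (of_real (2 * k) - 2 * \<i> * ?d))
      {- pi..pi}"
    using k by (subst has_integral_restrict) auto
  then have arc: "((\<lambda>t. ?K t * indicator {- k<..<k} t) has_integral (of_real (2 * k) - 2 * \<i> * ?d))
      {- pi..pi}"
    \<comment> \<open>The closed and the open arc differ only in two points, a null set.\<close>
    by (rule has_integral_spike[of "{- k, k}", rotated 2]) (auto simp: indicator_def)
  have "((\<lambda>t. Ln (lam + 1) * ?K t + Ln (rr lam) * (?K t * indicator {- k<..<k} t)) has_integral
      Ln (lam + 1) * of_real (2 * pi) + Ln (rr lam) * (of_real (2 * k) - 2 * \<i> * ?d)) {- pi..pi}"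
    by (intro has_integral_add has_integral_mult_right full arc)
  moreover have "Ln (lam + 1) * ?K t + Ln (rr lam) * (?K t * indicator {- k<..<k} t) =
      ?K t * ln_step_symbol k lam t" for t
    unfolding ln_step_symbol_def by (simp only: distrib_left mult_ac)
  ultimately have "integral {- pi..pi} (\<lambda>t. ?K t * ln_step_symbol k lam t) =
      Ln (lam + 1) * of_real (2 * pi) + Ln (rr lam) * (of_real (2 * k) - 2 * \<i> * ?d)"
    by (simp add: integral_unique)
  \<comment> \<open>Here -2i / (4 pi) = 1 / (2 pi i), the constant in \<open>beta\<close>.\<close>
  moreover have "1 / (4 * of_real pi) *
      (A * of_real (2 * pi) + B * (of_real (2 * k) - 2 * \<i> * C)) =
      A / 2 + of_real (k / (2 * pi)) * B + 1 / (2 * of_real pi * \<i>) * B * C" for A B C :: complex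
    by (simp add: field_simps)
  ultimately show ?thesis
    by (simp only: D_def szego_function_def beta_def)
qed

text \<open>Both arguments lie in (-pi/2, pi/2), so their difference stays in (-pi, pi) and no
  multiple of 2 pi i appears.\<close>

lemma Ln_divide_Re_pos:
  assumes "0 < Re x" "0 < Re y"
  shows "Ln (x / y) = Ln x - Ln y"
proof -
  have "x \<noteq> 0" "y \<noteq> 0" using assms by auto
  moreover have "\<bar>Im (Ln x)\<bar> < pi / 2" "\<bar>Im (Ln y)\<bar> < pi / 2"
    using assms Re_Ln_pos_lt_imp by auto
  ultimately show ?thesis
    by (intro Ln_unique) (auto simp: exp_diff)
qed

text \<open>In the polar form 2 sin k e^{i (k - pi/2)} the modulus is positive and the angle is
  principal, because 0 < k < pi.\<close>

lemma Ln_one_minus_cis_double: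
  assumes "0 < k" "k < pi"
  shows "Ln (1 - cis k * cis k) = of_real (ln (2 * sin k)) + \<i> * of_real (k - pi / 2)"
proof (rule Ln_unique)
  have s: "0 < sin k" using assms by (rule sin_gt_zero)
  have "exp (of_real (ln (2 * sin k)) + \<i> * of_real (k - pi / 2)) = of_real (2 * sin k) * cis (k - pi / 2)"
    unfolding exp_add cis_conv_exp exp_of_real using s by simp
  also have "\<dots> = 1 - cis k * cis k"
  proof -
    have "cos k * cos k = 1 - sin k * sin k"
      using sin_cos_squared_add3[of k] by linarith
    then show ?thesis
      by (simp add: complex_eq_iff cos_diff sin_diff algebra_simps)
  qed
  finally show "exp (of_real (ln (2 * sin k)) + \<i> * of_real (k - pi / 2)) = 1 - cis k * cis k" .
qed (use assms in auto)

lemma has_nontangential_limit_D_reg_fun: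
  assumes k: "0 < k" "k < pi"
  shows "has_nontangential_limit (D_reg_fun k lam) (cis k)
           (exp (Ln (lam + 1) / 2 + \<i> * of_real pi * beta lam / 2
             - beta lam * of_real (ln (2 * sin k))))"
  unfolding has_nontangential_limit_def
proof (intro allI impI)
  fix S assume "stolz_angle (cis k) S"
  then have S: "S \<subseteq> ball 0 1" by (auto simp: stolz_angle_def)
  \<comment> \<open>What remains of the exponent of \<open>D\<close> once
    \<open>- beta lam * Ln (1 - z * cis (- k))\<close> is added.\<close>
  define G where "G z = exp (Ln (lam + 1) / 2 + of_real (k / (2 * pi)) * Ln (rr lam)
      - beta lam * Ln (1 - z * cis k))" for z
  have eq: "D_reg_fun k lam z = G z" if "z \<in> S" for z
  proof -
    have z: "norm z < 1" using S that by auto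
    have "1 - z * cis (- k) \<noteq> 0"
      using z by (intro Re_pos_imp_nonzero Re_one_minus_mult_cis_pos)
    then show ?thesis
      by (simp add: D_reg_fun_def D_eq_exp[OF z k] powr_def G_def exp_add[symmetric] algebra_simps)
  qed
  \<comment> \<open>The real part is 2 sin^2 k, so \<open>Ln\<close> is continuous at this point and
    the limit of \<open>G\<close> is its value there.\<close>
  have "0 < Re (1 - cis k * cis k)"
  proof -
    have "0 < sin k * sin k" using sin_gt_zero[OF k] by simp
    moreover have "cos k * cos k = 1 - sin k * sin k"
      using sin_cos_squared_add3[of k] by linarith
    ultimately show ?thesis by simp
  qed
  then have "1 - cis k * cis k \<notin> \<real>\<^sub>\<le>\<^sub>0"
    using complex_nonpos_Reals_iff by auto
  then have "(G \<longlongrightarrow> G (cis k)) (at (cis k) within S)"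
    unfolding G_def by (intro tendsto_intros) auto
  \<comment> \<open>This term i k beta cancels the k-part of -beta i (k - pi/2), which leaves i pi
    beta / 2.\<close>
  moreover have "of_real (k / (2 * pi)) * Ln (rr lam) = \<i> * of_real k * beta lam"
    by (simp add: beta_def)
  then have "G (cis k) = exp (Ln (lam + 1) / 2 + \<i> * of_real pi * beta lam / 2
      - beta lam * of_real (ln (2 * sin k)))"
    by (simp add: G_def Ln_one_minus_cis_double[OF k] algebra_simps)
  ultimately have lim: "(G \<longlongrightarrow> exp (Ln (lam + 1) / 2 + \<i> * of_real pi * beta lam / 2
      - beta lam * of_real (ln (2 * sin k)))) (at (cis k) within S)"
    by simp
  have "\<forall>\<^sub>F z in at (cis k) within S. G z = D_reg_fun k lam z"
    using eq by (auto simp: eventually_at_filter)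
  with lim show "(D_reg_fun k lam \<longlongrightarrow> exp (Ln (lam + 1) / 2 + \<i> * of_real pi * beta lam / 2
      - beta lam * of_real (ln (2 * sin k)))) (at (cis k) within S)"
    by (rule Lim_transform_eventually)
qed

theorem mainTheorem1:
  fixes k :: real and lam :: complex
  assumes "0 < k" and "k < pi" and "lam \<noteq> 1" and "lam \<noteq> -1"
  shows "(\<forall>z. norm z < 1 \<longrightarrow>
            D k lam z =
              (lam + 1) powr (1 / 2) * rr lam powr of_real (k / (2 * pi)) *
              ((1 - z * cis (-k)) / (1 - z * cis k)) powr beta lam)
       \<and> has_nontangential_limit (D_reg_fun k lam) (cis k) (D_reg k lam)
       \<and> D_reg k lam =
            (lam + 1) powr (1 / 2) * exp (\<i> * of_real pi * beta lam / 2) *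
            of_real (2 * sin k) powr (- beta lam)
       \<and> D_reg k lam =
            exp (1 / 2 * Ln (lam + 1) + 1 / 4 * Ln ((lam - 1) / (lam + 1))
                 - 1 / (2 * of_real pi * \<i>) * Ln ((lam - 1) / (lam + 1)) * Ln (of_real (2 * sin k)))"
proof -
  \<comment> \<open>\<open>powr\<close> is 0 at base 0 and unfolds to an exponential only for a
    nonzero base.\<close>
  have ne: "lam + 1 \<noteq> 0" "rr lam \<noteq> 0"
    using assms(3,4) by (auto simp: rr_def add_eq_0_iff2)
  have s: "0 < 2 * sin k" using assms sin_gt_zero by simp
  then have Ln_s: "Ln (of_real (2 * sin k)) = of_real (ln (2 * sin k))"
    by (rule Ln_of_real)
  have closed: "D k lam z = (lam + 1) powr (1 / 2) * rr lam powr of_real (k / (2 * pi)) *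
      ((1 - z * cis (-k)) / (1 - z * cis k)) powr beta lam" if z: "norm z < 1" for z
  proof -
    note pos = Re_one_minus_mult_cis_pos[OF z]
    have "1 - z * cis (- k) \<noteq> 0" "1 - z * cis k \<noteq> 0"
      by (rule Re_pos_imp_nonzero, rule pos)+
    then show ?thesis
      using ne unfolding D_eq_exp[OF z assms(1,2)]
      by (simp add: powr_def Ln_divide_Re_pos[OF pos pos] exp_add)
  qed
  define L where "L = exp (Ln (lam + 1) / 2 + \<i> * of_real pi * beta lam / 2
      - beta lam * of_real (ln (2 * sin k)))"
  have lim: "has_nontangential_limit (D_reg_fun k lam) (cis k) L"
    unfolding L_def using assms(1,2) by (rule has_nontangential_limit_D_reg_fun)
  \<comment> \<open>Nontangential limits at a point of the unit circle are unique, so the definite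
    description behind \<open>D_reg\<close> picks out \<open>L\<close>.\<close>
  then have D_reg: "D_reg k lam = L"
    unfolding D_reg_def by (intro nontangential_Lim_eq) simp_all
  have "L = (lam + 1) powr (1 / 2) * exp (\<i> * of_real pi * beta lam / 2) *
      of_real (2 * sin k) powr (- beta lam)"
  proof -
    have "complex_of_real (2 * sin k) \<noteq> 0" using s by (simp only: of_real_eq_0_iff)
    then show ?thesis
      using ne unfolding powr_def Ln_s by (simp add: L_def exp_add[symmetric])
  qed
  moreover have "L = exp (1 / 2 * Ln (lam + 1) + 1 / 4 * Ln ((lam - 1) / (lam + 1))
      - 1 / (2 * of_real pi * \<i>) * Ln ((lam - 1) / (lam + 1)) * Ln (of_real (2 * sin k)))"
  proof -
    \<comment> \<open>Since log r = 2 pi i beta, a quarter of it is i pi beta / 2.\<close>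
    have "\<i> * of_real pi * beta lam / 2 = 1 / 4 * Ln (rr lam)"
      by (simp add: beta_def)
    then show ?thesis
      unfolding L_def Ln_s by (simp add: beta_def rr_def)
  qed
  ultimately show ?thesis
    using closed lim D_reg by simp
qed

end
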